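(* Let $R$ be a commutative ring with identity and $S\subseteq R$ a multiplicative set. If $R$ is an $S$-PF ring, then $R$ is an $S$-reduced ring.
   Context: A multiplicative set $S\subseteq R$ is a subset containing $1$ and closed under multiplication. For $a\in R$, $(0:a)=\{r\in R\mid ra=0\}$. An ideal $I$ of $R$ is $S$-pure if for all $a\in I$ there exist $b\in I$ and $s\in S$ such that $sa=ab$. $R$ is an $S$-PF ring if for every $a\in R$ the ideal $(0:a)$ is $S$-pure, i.e. for each $x\in(0:a)$ there exist $y\in(0:a)$ and $s\in S$ such that $xy=sx$. $R$ is $S$-reduced if for every $r\in R$ with $r^n=0$ for some $n\in\mathbb{N}$, there exists $s\in S$ (possibly depending on $r$) with $sr=0$. *)

theory Defs
  imports "HOL-Algebra.Ideal"
begin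

definition annihilator :: "('a, 'm) ring_scheme \<Rightarrow> 'a \<Rightarrow> 'a set" where
  "annihilator R a = {r \<in> carrier R. r \<otimes>\<^bsub>R\<^esub> a = \<zero>\<^bsub>R\<^esub>}"

definition S_pure :: "('a, 'm) ring_scheme \<Rightarrow> 'a set \<Rightarrow> 'a set \<Rightarrow> bool" where
  "S_pure R S I \<longleftrightarrow>
     ideal I R \<and> (\<forall>a\<in>I. \<exists>b\<in>I. \<exists>s\<in>S. s \<otimes>\<^bsub>R\<^esub> a = a \<otimes>\<^bsub>R\<^esub> b)"

definition S_PF_ring :: "('a, 'm) ring_scheme \<Rightarrow> 'a set \<Rightarrow> bool" where
  "S_PF_ring R S \<longleftrightarrow> (\<forall>a\<in>carrier R. S_pure R S (annihilator R a))"

(* The exponent n = 0 is harmless: r^0 = 0 forces the ring to be trivial. *)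
definition S_reduced_ring :: "('a, 'm) ring_scheme \<Rightarrow> 'a set \<Rightarrow> bool" where
  "S_reduced_ring R S \<longleftrightarrow>
     (\<forall>r\<in>carrier R. (\<exists>n::nat. r [^]\<^bsub>R\<^esub> n = \<zero>\<^bsub>R\<^esub>) \<longrightarrow> (\<exists>s\<in>S. s \<otimes>\<^bsub>R\<^esub> r = \<zero>\<^bsub>R\<^esub>))"

lemma (in cring) annihilator_ideal:
  assumes "a \<in> carrier R"
  shows "ideal (annihilator R a) R"
proof (rule idealI)
  show "subgroup (annihilator R a) (add_monoid R)"
    using assms
    by (intro add.subgroupI) (auto simp: annihilator_def l_distr l_minus a_inv_def[symmetric])
next
  fix x r assume "x \<in> annihilator R a" and r: "r \<in> carrier R"
  then have x: "x \<in> carrier R" "x \<otimes> a = \<zero>"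
    by (auto simp: annihilator_def)
  have *: "(r \<otimes> x) \<otimes> a = \<zero>"
    using x r assms by (simp add: m_assoc)
  then show "r \<otimes> x \<in> annihilator R a"
    using x r by (simp add: annihilator_def)
  show "x \<otimes> r \<in> annihilator R a"
    using * x r by (simp add: annihilator_def m_comm[of x r])
qed (rule ring_axioms)

lemma (in cring) S_PF_ring_iff:
  "S_PF_ring R S \<longleftrightarrow>
     (\<forall>a\<in>carrier R. \<forall>x\<in>annihilator R a. \<exists>y\<in>annihilator R a. \<exists>s\<in>S. x \<otimes> y = s \<otimes> x)"
  using annihilator_ideal unfolding S_PF_ring_def S_pure_def by metis

end

theory Submission
  imports Defs
begin

(* If r^(n+1) = 0 with n > 0, then r lies in (0 : r^n), so s r = r y for some s in S and y in
   (0 : r^n). Hence (s r)^n = r^n y^n = 0, and induction on n yields t in S with t s r = 0. *)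

text \<open>Each use of purity lowers the exponent of nilpotency by one, at the cost of a factor
  from \<open>S\<close>; since \<open>S\<close> is closed under products, the collected factors form
  a single multiplier in \<open>S\<close>.\<close>

lemma (in cring) S_PF_nilpotent_annihilated:
  assumes S: "submonoid S R" and PF: "S_PF_ring R S"
    and "r \<in> carrier R" and "r [^] (n::nat) = \<zero>"
  shows "\<exists>s\<in>S. s \<otimes> r = \<zero>"
  using assms(3,4)
proof (induction n arbitrary: r)
  case 0
  \<comment> \<open>Here 1 = r^0 = 0, so the ring is trivial.\<close>
  then have "r = \<zero>"
    by (metis l_null l_one nat_pow_0)
  then show ?case
    using submonoid.one_closed[OF S] by (auto intro!: bexI[of _ \<one>])
next
  case (Suc n)
  show ?case
  \<comment> \<open>The main step takes one factor \<open>y\<close> out of y^n, hence needs n > 0;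
    for n = 0 the hypothesis already says r = 0.\<close>
  proof (cases n)
    case 0
    then show ?thesis
      using Suc.prems submonoid.one_closed[OF S] by (auto intro!: bexI[of _ \<one>])
  next
    case (Suc m)
    have r: "r \<in> carrier R" by fact
    have "r \<in> annihilator R (r [^] n)"
      using Suc.prems nat_pow_Suc2[OF r, of n] by (simp add: annihilator_def)
    then obtain y s where y: "y \<in> annihilator R (r [^] n)" and s: "s \<in> S"
      and eq: "r \<otimes> y = s \<otimes> r"
      using PF r unfolding S_PF_ring_iff by (meson nat_pow_closed)
    have sR: "s \<in> carrier R"
      using s submonoid.subset[OF S] by blast
    have yR: "y \<in> carrier R" and y0: "r [^] n \<otimes> y = \<zero>"
      using y r by (auto simp: annihilator_def m_comm)
    \<comment> \<open>By \<open>eq\<close> the power is (r y)^n; a single \<open>y\<close> is placed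
      next to r^n, which it annihilates.\<close>
    have "(s \<otimes> r) [^] n = r [^] n \<otimes> (y \<otimes> y [^] m)"
      using nat_pow_distrib[OF r yR, of n] nat_pow_Suc2[OF yR, of m] \<open>n = Suc m\<close>
      by (simp only: eq)
    also have "\<dots> = \<zero>"
      using y0 r yR by (simp add: m_assoc[symmetric] del: nat_pow_Suc)
    \<comment> \<open>The induction hypothesis is applied to s r in place of
      \<open>r\<close>.\<close>
    finally obtain t where t: "t \<in> S" "t \<otimes> (s \<otimes> r) = \<zero>"
      using Suc.IH[of "s \<otimes> r"] sR r by auto
    then have "(t \<otimes> s) \<otimes> r = \<zero>"
      using submonoid.subset[OF S] sR r by (metis m_assoc subsetD)
    then show ?thesis
      using submonoid.m_closed[OF S] t(1) s by blast
  qed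
qed

theorem mainTheorem5:
  fixes R (structure) and S :: "'a set"
  assumes "cring R"
    and "submonoid S R"
    and "S_PF_ring R S"
  shows "S_reduced_ring R S"
  unfolding S_reduced_ring_def
  using cring.S_PF_nilpotent_annihilated[OF assms] by blast

end
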